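(* Let $\overline{n}=(n_1,\dots,n_t)\in\mathbb{N}_{>0}^t$ and $\overline{m}=(m_1,\dots,m_t)\in\mathbb{N}^t$ uniquely characterize a simple game $v$ with minimum. If $v$ does not contain veto players but contains null players, then $\dim(v)=t-1$.
   Context: A simple game is a pair $(N,v)$ with $N$ a finite nonempty set of players and $v:2^N\to\{0,1\}$ satisfying $v(\emptyset)=0$, $v(N)=1$ and $v(S)\le v(T)$ whenever $S\subseteq T$. A coalition $S$ is winning if $v(S)=1$ and losing otherwise; it is minimal winning if it is winning and all its proper subsets are losing. $\mathbb N$ includes $0$. Players $a,b$ are equivalent (equi-desirable) if the transposition of $a$ and $b$ preserves the set of winning coalitions; let $N_1,\dots,N_t$ be the equivalence classes. To a coalition $S$ associate the vector $(|S\cap N_1|,\dots,|S\cap N_t|)$. The vectors of minimal winning coalitions are called minimal winning vectors. A simple game with minimum is a simple game with exactly one minimal winning vector. That $(\overline n,\overline m)$ uniquely characterizes the simple game $v$ with minimum means: $v$ has exactly the $t$ equivalence classes $N_1,\dots,N_t$ with $|N_i|=n_i$, and its unique minimal winning vector is $\overline m$; so $S$ is winning iff $|S\cap N_i|\ge m_i$ for all $i$. A player is null if it belongs to no minimal winning coalition (the players of $N_i$ are null iff $m_i=0$), and veto if it belongs to every winning coalition (the players of $N_i$ are veto iff $m_i=n_i$). A simple game $(N,v)$ is weighted if there are weights $w_i\in\mathbb R$ ($i\in N$) and a quota $q\in\mathbb R$ with $\sum_{i\in W}w_i\ge q>\sum_{i\in L}w_i$ for every winning coalition $W$ and every losing coalition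 $L$. The intersection of simple games on the same player set $N$ is the game in which a coalition is winning iff it is winning in each of them. The dimension $\dim(v)$ is the smallest integer $k\ge1$ such that $v$ is the intersection of $k$ weighted games on $N$. *)

theory Defs
  imports Complex_Main "HOL-Combinatorics.Transposition"
begin

text \<open>
  A game is a function on coalitions of a finite player set \<open>N\<close>; its values on sets that are
  not subsets of \<open>N\<close> are irrelevant and ignored by every notion below.
\<close>

definition simple_game :: "'a set \<Rightarrow> ('a set \<Rightarrow> nat) \<Rightarrow> bool" where
  "simple_game N v \<longleftrightarrow>
     finite N \<and> N \<noteq> {} \<and>
     (\<forall>S. S \<subseteq> N \<longrightarrow> v S \<in> {0, 1}) \<and>
     v {} = 0 \<and> v N = 1 \<and>
     (\<forall>S T. S \<subseteq> T \<and> T \<subseteq> N \<longrightarrow> v S \<le> v T)"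

definition winning :: "'a set \<Rightarrow> ('a set \<Rightarrow> nat) \<Rightarrow> 'a set \<Rightarrow> bool" where
  "winning N v S \<longleftrightarrow> S \<subseteq> N \<and> v S = 1"

definition losing :: "'a set \<Rightarrow> ('a set \<Rightarrow> nat) \<Rightarrow> 'a set \<Rightarrow> bool" where
  "losing N v S \<longleftrightarrow> S \<subseteq> N \<and> v S \<noteq> 1"

definition minimal_winning :: "'a set \<Rightarrow> ('a set \<Rightarrow> nat) \<Rightarrow> 'a set \<Rightarrow> bool" where
  "minimal_winning N v S \<longleftrightarrow> winning N v S \<and> (\<forall>T. T \<subset> S \<longrightarrow> losing N v T)"

definition null_player :: "'a set \<Rightarrow> ('a set \<Rightarrow> nat) \<Rightarrow> 'a \<Rightarrow> bool" where
  "null_player N v a \<longleftrightarrow> a \<in> N \<and> \<not> (\<exists>S. minimal_winning N v S \<and> a \<in> S)"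

definition veto_player :: "'a set \<Rightarrow> ('a set \<Rightarrow> nat) \<Rightarrow> 'a \<Rightarrow> bool" where
  "veto_player N v a \<longleftrightarrow> a \<in> N \<and> (\<forall>S. winning N v S \<longrightarrow> a \<in> S)"

definition equi_desirable :: "'a set \<Rightarrow> ('a set \<Rightarrow> nat) \<Rightarrow> ('a \<times> 'a) set" where
  "equi_desirable N v =
     {(a, b). a \<in> N \<and> b \<in> N \<and>
        (\<lambda>S. transpose a b ` S) ` {S. winning N v S} = {S. winning N v S}}"

text \<open>The list \<open>Cs\<close> enumerates the equivalence classes \<open>N\<^sub>1, \<dots>, N\<^sub>t\<close> without repetition.\<close>

definition class_enumeration :: "'a set \<Rightarrow> ('a set \<Rightarrow> nat) \<Rightarrow> 'a set list \<Rightarrow> bool" where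
  "class_enumeration N v Cs \<longleftrightarrow> distinct Cs \<and> set Cs = N // equi_desirable N v"

definition coalition_vector :: "'a set list \<Rightarrow> 'a set \<Rightarrow> nat list" where
  "coalition_vector Cs S = map (\<lambda>C. card (S \<inter> C)) Cs"

definition minimal_winning_vectors ::
    "'a set \<Rightarrow> ('a set \<Rightarrow> nat) \<Rightarrow> 'a set list \<Rightarrow> nat list set" where
  "minimal_winning_vectors N v Cs = coalition_vector Cs ` {S. minimal_winning N v S}"

text \<open>
  The number of minimal winning vectors does not depend on the enumeration, since changing it only
  permutes the entries of all vectors.
\<close>

definition simple_game_with_minimum :: "'a set \<Rightarrow> ('a set \<Rightarrow> nat) \<Rightarrow> bool" where
  "simple_game_with_minimum N v \<longleftrightarrow>
     simple_game N v \<and>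
     (\<exists>Cs. class_enumeration N v Cs \<and> (\<exists>!x. x \<in> minimal_winning_vectors N v Cs))"

definition characterizes ::
    "nat list \<Rightarrow> nat list \<Rightarrow> 'a set \<Rightarrow> ('a set \<Rightarrow> nat) \<Rightarrow> bool" where
  "characterizes n m N v \<longleftrightarrow>
     simple_game_with_minimum N v \<and>
     (\<exists>Cs. class_enumeration N v Cs \<and> map card Cs = n \<and>
           minimal_winning_vectors N v Cs = {m})"

definition weighted_game :: "'a set \<Rightarrow> ('a set \<Rightarrow> nat) \<Rightarrow> bool" where
  "weighted_game N v \<longleftrightarrow>
     simple_game N v \<and>
     (\<exists>(w :: 'a \<Rightarrow> real) (q :: real).
        (\<forall>W. winning N v W \<longrightarrow> q \<le> (\<Sum>i\<in>W. w i)) \<and>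
        (\<forall>L. losing N v L \<longrightarrow> (\<Sum>i\<in>L. w i) < q))"

definition is_intersection ::
    "'a set \<Rightarrow> ('a set \<Rightarrow> nat) \<Rightarrow> nat \<Rightarrow> (nat \<Rightarrow> 'a set \<Rightarrow> nat) \<Rightarrow> bool" where
  "is_intersection N v k g \<longleftrightarrow>
     (\<forall>S. S \<subseteq> N \<longrightarrow> (winning N v S \<longleftrightarrow> (\<forall>j<k. winning N (g j) S)))"

text \<open>
  For a simple game the minimum is taken over a nonempty set: every simple game is the intersection
  of the weighted games \<open>S \<mapsto> (if S \<subseteq> L then 0 else 1)\<close>, where \<open>L\<close> ranges over its losing
  coalitions.
\<close>

definition dimension :: "'a set \<Rightarrow> ('a set \<Rightarrow> nat) \<Rightarrow> nat" where
  "dimension N v =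
     (LEAST k. 1 \<le> k \<and> (\<exists>g. (\<forall>j<k. weighted_game N (g j)) \<and> is_intersection N v k g))"

end

theory Submission
  imports Defs
begin

text \<open>
  A simple game with minimum is given by thresholds: a coalition wins iff it contains, for each
  equivalence class \<open>C\<close>, at least \<open>r C\<close> players of \<open>C\<close> (lemma \<open>winning_iff_thresholds\<close>). Indeed a
  player may be exchanged for an equivalent one without losing the win, so only the counts matter,
  and every winning coalition contains a minimal one, all of which have the same counts. A class with
  threshold \<open>0\<close> imposes no condition. Any two players of such classes are interchangeable, so there
  is at most one such class; if there are null players, there is exactly one. What remains are
  \<open>t - 1\<close> conditions, on pairwise disjoint classes, with \<open>0 < r C\<close>, and with \<open>r C < card C\<close> because
  there are no veto players.

  The dimension of such a game is the number of conditions (lemma \<open>dimension_threshold_game\<close>). Each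
  single condition is a weighted game, which gives the upper bound. For the lower bound, let \<open>L C\<close> be
  a losing coalition that fails the condition of \<open>C\<close> by one player and contains everybody outside
  \<open>C\<close>. For \<open>C \<noteq> D\<close> the coalitions \<open>L C\<close> and \<open>L D\<close> can swap one player of \<open>C\<close> against one of \<open>D\<close>, and
  both become winning, since \<open>L C\<close> can spare a player of \<open>D\<close> and conversely. The total weight
  does not change in a swap, so no weighted game that lets all winning coalitions win can defeat both
  \<open>L C\<close> and \<open>L D\<close>. Hence every class needs a weighted game of its own.
\<close>

section \<open>Intersections of weighted games\<close>

text \<open>
  A weighted game cannot lose two coalitions whose players can be redistributed into two winning
  ones, because the total weight is the same before and after. So the losing coalitions \<open>L i\<close> are
  excluded by pairwise different components of the intersection.
\<close>

lemma card_le_of_tradeable_losing: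
  assumes fin: "finite N"
    and lose: "\<And>i. i \<in> I \<Longrightarrow> losing N v (L i)"
    and trade: "\<And>i j. i \<in> I \<Longrightarrow> j \<in> I \<Longrightarrow> i \<noteq> j \<Longrightarrow>
      \<exists>V W. winning N v V \<and> winning N v W \<and> V \<union> W = L i \<union> L j \<and> V \<inter> W = L i \<inter> L j"
    and weighted: "\<And>k. k < d \<Longrightarrow> weighted_game N (g k)"
    and inter: "is_intersection N v d g"
  shows "card I \<le> d"
proof -
  have "\<exists>k<d. losing N (g k) (L i)" if "i \<in> I" for i
    using lose[OF that] inter unfolding is_intersection_def losing_def winning_def by blast
  then obtain f where f: "\<And>i. i \<in> I \<Longrightarrow> f i < d \<and> losing N (g (f i)) (L i)"
    by metis
  have "inj_on f I"
  proof (rule inj_onI, rule ccontr)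
    fix i j assume ij: "i \<in> I" "j \<in> I" "f i = f j" "i \<noteq> j"
    define k where "k = f i"
    have k: "k < d" "losing N (g k) (L i)" "losing N (g k) (L j)"
      using f[OF ij(1)] f[OF ij(2)] ij(3) unfolding k_def by simp_all
    obtain w :: "'a \<Rightarrow> real" and q where
      q: "\<And>S. winning N (g k) S \<Longrightarrow> q \<le> sum w S" "\<And>S. losing N (g k) S \<Longrightarrow> sum w S < q"
      using weighted[OF k(1)] unfolding weighted_game_def by blast
    obtain V W where VW: "winning N v V" "winning N v W"
      and swap: "V \<union> W = L i \<union> L j" "V \<inter> W = L i \<inter> L j"
      using trade ij by blast
    have "winning N (g k) V" "winning N (g k) W"
      using VW inter k(1) unfolding is_intersection_def winning_def by blast+
    then have "q + q \<le> sum w V + sum w W"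
      using q(1) by (intro add_mono)
    also have "\<dots> = sum w (V \<union> W) + sum w (V \<inter> W)"
      using VW fin by (intro sum.union_inter[symmetric]) (auto simp: winning_def intro: finite_subset)
    also have "\<dots> = sum w (L i) + sum w (L j)"
      unfolding swap using k fin
      by (intro sum.union_inter) (auto simp: losing_def intro: finite_subset)
    also have "\<dots> < q + q"
      using q(2) k by (intro add_strict_mono)
    finally show False by simp
  qed
  then have "card I \<le> card {..<d}"
    using f by (intro card_inj_on_le) auto
  then show ?thesis by simp
qed

definition quorum_game :: "'a set \<Rightarrow> nat \<Rightarrow> 'a set \<Rightarrow> nat" where
  "quorum_game C r S = (if r \<le> card (S \<inter> C) then 1 else 0)"

lemma weighted_quorum_game:
  assumes "finite N" "C \<subseteq> N" "0 < r" "r \<le> card C"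
  shows "weighted_game N (quorum_game C r)"
proof -
  have finS: "finite S" if "S \<subseteq> N" for S
    using that assms(1) by (rule finite_subset)
  have "N \<noteq> {}" using assms by auto
  moreover have "card (S \<inter> C) \<le> card (T \<inter> C)" if "S \<subseteq> T" "T \<subseteq> N" for S T
    using that finS by (intro card_mono) auto
  moreover have "N \<inter> C = C" using assms(2) by blast
  ultimately have simple: "simple_game N (quorum_game C r)"
    using assms unfolding simple_game_def quorum_game_def by (auto intro: order_trans)
  define w :: "'a \<Rightarrow> real" where "w x = of_bool (x \<in> C)" for x
  have w: "sum w S = card (S \<inter> C)" if "S \<subseteq> N" for S
    using finS[OF that] by (simp add: w_def Int_def)
  have "\<forall>S. winning N (quorum_game C r) S \<longrightarrow> real r \<le> sum w S"
    "\<forall>S. losing N (quorum_game C r) S \<longrightarrow> sum w S < real r"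
    using w by (auto simp: winning_def losing_def quorum_game_def split: if_splits)
  then show ?thesis
    using simple unfolding weighted_game_def by blast
qed

text \<open>
  The bounds on \<open>r C\<close> are what the lower bound rests on: \<open>0 < r C\<close> allows a coalition to miss the
  quota of \<open>C\<close> by one player, and \<open>r C < card C\<close> lets a coalition containing \<open>C\<close> give one player
  of \<open>C\<close> away.
\<close>

lemma dimension_threshold_game:
  assumes fin: "finite N"
    and sub: "\<And>C. C \<in> \<C> \<Longrightarrow> C \<subseteq> N"
    and disj: "\<And>C D. C \<in> \<C> \<Longrightarrow> D \<in> \<C> \<Longrightarrow> C \<noteq> D \<Longrightarrow> C \<inter> D = {}"
    and nonempty: "\<C> \<noteq> {}"
    and pos: "\<And>C. C \<in> \<C> \<Longrightarrow> 0 < r C"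
    and less: "\<And>C. C \<in> \<C> \<Longrightarrow> r C < card C"
    and win: "\<And>S. winning N v S \<longleftrightarrow> S \<subseteq> N \<and> (\<forall>C\<in>\<C>. r C \<le> card (S \<inter> C))"
  shows "dimension N v = card \<C>"
  unfolding dimension_def
proof (rule Least_equality)
  have "\<C> \<subseteq> Pow N" using sub by blast
  then have fin\<C>: "finite \<C>" using fin by (auto intro: finite_subset)
  obtain h where h: "bij_betw h {..<card \<C>} \<C>"
    using ex_bij_betw_nat_finite[OF fin\<C>] by (auto simp: atLeast0LessThan)
  define g where "g k = quorum_game (h k) (r (h k))" for k
  have range_h: "h ` {..<card \<C>} = \<C>"
    using h by (rule bij_betw_imp_surj_on)
  have h_in: "h k \<in> \<C>" if "k < card \<C>" for k
    using range_h that by blast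
  have "weighted_game N (g k)" if "k < card \<C>" for k
    unfolding g_def using h_in[OF that] fin sub pos less
    by (intro weighted_quorum_game) (auto intro: less_imp_le)
  moreover have "is_intersection N v (card \<C>) g"
  proof -
    have "(\<forall>C \<in> h ` {..<card \<C>}. P C) \<longleftrightarrow> (\<forall>k<card \<C>. P (h k))" for P
      by auto
    then have "(\<forall>C\<in>\<C>. P C) \<longleftrightarrow> (\<forall>k<card \<C>. P (h k))" for P
      unfolding range_h .
    then show ?thesis
      unfolding is_intersection_def win by (auto simp: winning_def g_def quorum_game_def)
  qed
  moreover have "1 \<le> card \<C>"
    using fin\<C> nonempty by (simp add: Suc_leI card_gt_0_iff)
  ultimately show "1 \<le> card \<C> \<and>
      (\<exists>g. (\<forall>k<card \<C>. weighted_game N (g k)) \<and> is_intersection N v (card \<C>) g)"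
    by blast
next
  fix d assume "1 \<le> d \<and> (\<exists>g. (\<forall>k<d. weighted_game N (g k)) \<and> is_intersection N v d g)"
  then obtain g where g: "\<And>k. k < d \<Longrightarrow> weighted_game N (g k)" "is_intersection N v d g"
    by blast
  have fin_class: "finite C" if "C \<in> \<C>" for C
    using sub[OF that] fin by (rule finite_subset)
  have "\<exists>K\<subseteq>C. card K = r C - 1" if "C \<in> \<C>" for C
    using obtain_subset_with_card_n[of "r C - 1" C] less[OF that] by fastforce
  then obtain K where K: "\<And>C. C \<in> \<C> \<Longrightarrow> K C \<subseteq> C" "\<And>C. C \<in> \<C> \<Longrightarrow> card (K C) = r C - 1"
    by metis
  define L where "L C = (N - C) \<union> K C" for C
  have L_sub: "L C \<subseteq> N" if "C \<in> \<C>" for C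
    using K(1) sub that unfolding L_def by blast
  have L_own: "L C \<inter> C = K C" if "C \<in> \<C>" for C
    using K(1) that unfolding L_def by blast
  have L_other: "L C \<inter> D = D" if "C \<in> \<C>" "D \<in> \<C>" "C \<noteq> D" for C D
    using disj[OF that] sub[OF that(2)] unfolding L_def by blast
  have fails: "card (L C \<inter> C) < r C" if "C \<in> \<C>" for C
    using K(2)[OF that] pos[OF that] L_own[OF that] by simp
  have lose: "losing N v (L C)" if "C \<in> \<C>" for C
  proof -
    have "\<not> winning N v (L C)"
      using fails[OF that] that unfolding win by fastforce
    then show ?thesis
      using L_sub[OF that] by (auto simp: losing_def winning_def)
  qed
  \<comment> \<open>The gain \<open>a\<close> repairs the only failing condition, and the loss of \<open>b\<close> is covered by the
    surplus of \<open>L C\<close> in \<open>D\<close>.\<close>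
  have swap_wins: "winning N v (insert a (L C) - {b})"
    if CD: "C \<in> \<C>" "D \<in> \<C>" "C \<noteq> D" and ab: "a \<in> C - K C" "b \<in> D" for C D a b
  proof -
    have "r E \<le> card ((insert a (L C) - {b}) \<inter> E)" if E: "E \<in> \<C>" for E
    proof -
      consider "E = C" | "E = D" | "E \<noteq> C" "E \<noteq> D" by blast
      then show ?thesis
      proof cases
        case 1
        have "(insert a (L C) - {b}) \<inter> C = insert a (K C)"
          using ab L_own[OF CD(1)] disj[OF CD] K(1)[OF CD(1)] by blast
        moreover have "finite (K C)"
          using K(1)[OF CD(1)] fin_class[OF CD(1)] by (rule finite_subset)
        ultimately show ?thesis
          using 1 K(2)[OF CD(1)] ab by simp
      next
        case 2
        have "(insert a (L C) - {b}) \<inter> D = D - {b}"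
          using ab L_other[OF CD] disj[OF CD] by blast
        then show ?thesis
          using 2 less[OF CD(2)] ab fin_class[OF CD(2)] by simp
      next
        case 3
        have "(insert a (L C) - {b}) \<inter> E = E"
          using L_other[OF CD(1) E] disj[OF CD(1) E] disj[OF CD(2) E] 3 ab by blast
        then show ?thesis
          using less[OF E] by simp
      qed
    qed
    then show ?thesis
      using L_sub[OF CD(1)] sub[OF CD(1)] ab unfolding win by blast
  qed
  have outsider: "\<exists>a. a \<in> C - K C" if "C \<in> \<C>" for C
    using K[OF that] less[OF that] by (cases "K C = C") auto
  have "\<exists>V W. winning N v V \<and> winning N v W \<and> V \<union> W = L C \<union> L D \<and> V \<inter> W = L C \<inter> L D"
    if CD: "C \<in> \<C>" "D \<in> \<C>" "C \<noteq> D" for C D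
  proof -
    obtain a b where ab: "a \<in> C - K C" "b \<in> D - K D"
      using outsider CD by metis
    have mem: "a \<in> L D" "a \<notin> L C" "b \<in> L C" "b \<notin> L D"
      using ab L_own[OF CD(1)] L_own[OF CD(2)] L_other[OF CD] L_other[OF CD(2,1)] CD(3) by blast+
    have "winning N v (insert a (L C) - {b})" "winning N v (insert b (L D) - {a})"
      using swap_wins[OF CD] swap_wins[OF CD(2,1)] CD(3) ab by blast+
    moreover have "(insert a (L C) - {b}) \<union> (insert b (L D) - {a}) = L C \<union> L D"
      "(insert a (L C) - {b}) \<inter> (insert b (L D) - {a}) = L C \<inter> L D"
      using mem by auto
    ultimately show ?thesis by blast
  qed
  then show "card \<C> \<le> d"
    by (intro card_le_of_tradeable_losing[where L = L, OF fin lose _ g])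
qed

section \<open>Equivalent players\<close>

lemma equi_desirable_iff:
  "(a, b) \<in> equi_desirable N v \<longleftrightarrow>
     a \<in> N \<and> b \<in> N \<and> (\<forall>S. winning N v (transpose a b ` S) \<longleftrightarrow> winning N v S)"
proof -
  have invol: "transpose a b ` transpose a b ` S = S" for S
    by (simp add: image_comp)
  have "(\<lambda>S. transpose a b ` S) ` {S. winning N v S} = {S. winning N v S} \<longleftrightarrow>
     (\<forall>S. winning N v (transpose a b ` S) \<longleftrightarrow> winning N v S)" (is "?l = _ \<longleftrightarrow> ?r")
  proof
    assume eq: "?l = {S. winning N v S}"
    have pres: "winning N v (transpose a b ` S)" if "winning N v S" for S
      using that eq by blast
    then show ?r using pres invol by metis
  next
    assume r: ?r
    have "S \<in> ?l" if "winning N v S" for S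
      using r that invol[of S] by (metis image_eqI mem_Collect_eq)
    then show "?l = {S. winning N v S}" using r by blast
  qed
  then show ?thesis by (simp add: equi_desirable_def)
qed

lemma equiv_equi_desirable: "equiv N (equi_desirable N v)"
proof (rule equivI)
  show "equi_desirable N v \<subseteq> N \<times> N" by (auto simp: equi_desirable_def)
  show refl: "refl_on N (equi_desirable N v)" by (auto simp: refl_on_def equi_desirable_iff)
  show "sym (equi_desirable N v)"
    by (rule symI) (auto simp: equi_desirable_iff transpose_commute)
  show "trans (equi_desirable N v)"
  proof (rule transI)
    fix a b c assume ab: "(a, b) \<in> equi_desirable N v" and bc: "(b, c) \<in> equi_desirable N v"
    show "(a, c) \<in> equi_desirable N v"
    proof (cases "a = c \<or> b = c")
      case True
      moreover have "a \<in> N" using ab by (simp add: equi_desirable_iff)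
      ultimately show ?thesis using ab refl_onD[OF refl] by blast
    next
      case False
      \<comment> \<open>Transpositions that preserve the winning coalitions are closed under conjugation.\<close>
      then have conj: "transpose a b \<circ> transpose b c \<circ> transpose a b = transpose a c"
        by (intro transpose_comp_triple) auto
      have "transpose a c ` S = transpose a b ` transpose b c ` transpose a b ` S" for S
        unfolding conj[symmetric] image_comp comp_assoc ..
      then show ?thesis
        using ab bc unfolding equi_desirable_iff by metis
    qed
  qed
qed

lemma transpose_image_exchange:
  assumes "a \<in> S" "b \<notin> S"
  shows "transpose a b ` S = insert b (S - {a})"
  using assms by (auto simp: transpose_def image_iff)

text \<open>
  Unless \<open>M \<subseteq> S\<close>, some \<open>a \<in> M - S\<close> can be exchanged for an equivalent \<open>b \<in> S - M\<close>: this keeps all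
  counts of \<open>M\<close> and brings \<open>M\<close> closer to \<open>S\<close>, so that the claim reduces to monotonicity.
\<close>

lemma winning_of_class_counts_le:
  assumes game: "simple_game N v"
    and "winning N v M" and "S \<subseteq> N"
    and "\<And>C. C \<in> N // equi_desirable N v \<Longrightarrow> card (M \<inter> C) \<le> card (S \<inter> C)"
  shows "winning N v S"
  using assms(2,4)
proof (induction "card (M - S)" arbitrary: M rule: less_induct)
  case less
  let ?E = "equi_desirable N v"
  note eq = equiv_equi_desirable[of N v]
  have fin: "finite N" using game by (simp add: simple_game_def)
  have M: "M \<subseteq> N" "v M = 1" using less.prems(1) by (auto simp: winning_def)
  have finM: "finite M" using M fin by (auto intro: finite_subset)
  show ?case
  proof (cases "M \<subseteq> S")
    case True
    then have "1 \<le> v S" "v S \<in> {0, 1}"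
      using game \<open>S \<subseteq> N\<close> M unfolding simple_game_def by metis+
    then show ?thesis using \<open>S \<subseteq> N\<close> by (auto simp: winning_def)
  next
    case False
    then obtain a where a: "a \<in> M" "a \<notin> S" by blast
    define C where "C = ?E `` {a}"
    have C: "C \<in> N // ?E" using a M unfolding C_def by (auto intro: quotientI)
    have aC: "a \<in> C"
      unfolding C_def using a M by (intro equiv_class_self[OF eq]) auto
    have "\<exists>b. b \<in> S \<inter> C - M"
    proof (rule ccontr)
      assume "\<not> ?thesis"
      then have "S \<inter> C \<subset> M \<inter> C" using a aC by blast
      then have "card (S \<inter> C) < card (M \<inter> C)" using finM by (intro psubset_card_mono) auto
      then show False using less.prems(2)[OF C] by simp
    qed
    then obtain b where b: "b \<in> S" "b \<in> C" "b \<notin> M" by blast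
    define M' where "M' = insert b (M - {a})"
    have M': "M' = transpose a b ` M"
      using transpose_image_exchange a b unfolding M'_def by metis
    have ab: "(a, b) \<in> ?E" using b unfolding C_def by simp
    have "winning N v M'"
      using ab less.prems(1) unfolding M' equi_desirable_iff by blast
    moreover have "card (M' - S) < card (M - S)"
    proof -
      have "M' - S \<subset> M - S" using a b unfolding M'_def by auto
      then show ?thesis using finM by (intro psubset_card_mono) auto
    qed
    moreover have "card (M' \<inter> D) \<le> card (S \<inter> D)" if D: "D \<in> N // ?E" for D
    proof (cases "D = C")
      case True
      have "M' \<inter> C = insert b (M \<inter> C - {a})" using b unfolding M'_def by blast
      then have "card (M' \<inter> C) = Suc (card (M \<inter> C - {a}))" using b finM by simp
      also have "\<dots> = card (M \<inter> C)" using a aC finM by (intro card_Suc_Diff1) auto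
      finally show ?thesis using less.prems(2)[OF C] True by simp
    next
      case False
      then have "D \<inter> C = {}" using quotient_disj[OF eq D C] by blast
      then have "M' \<inter> D = M \<inter> D" using aC b unfolding M'_def by blast
      then show ?thesis using less.prems(2)[OF D] by simp
    qed
    ultimately show ?thesis using less.hyps by blast
  qed
qed

section \<open>Games with minimum\<close>

lemma winning_contains_minimal:
  assumes "finite N" "winning N v S"
  shows "\<exists>T\<subseteq>S. minimal_winning N v T"
proof -
  have "S \<subseteq> N" using assms by (simp add: winning_def)
  then have "finite S" using assms(1) by (rule finite_subset)
  let ?W = "{T. T \<subseteq> S \<and> winning N v T}"
  have "finite ?W" using \<open>finite S\<close> by simp
  moreover have "?W \<noteq> {}" using assms(2) by blast
  ultimately obtain T where "T \<in> ?W" and min: "\<forall>U\<in>?W. U \<subseteq> T \<longrightarrow> T = U"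
    using finite_has_minimal[of ?W] by blast
  then have T: "T \<subseteq> S" "winning N v T" by simp_all
  have "losing N v U" if "U \<subset> T" for U
  proof -
    have "\<not> winning N v U" using min that T by auto
    then show ?thesis using that T by (auto simp: winning_def losing_def)
  qed
  then show ?thesis using T unfolding minimal_winning_def by blast
qed

text \<open>
  Necessity of the thresholds uses that every winning coalition contains a minimal one, sufficiency
  that a single minimal winning coalition can be exchanged into any coalition with large enough
  counts.
\<close>

lemma winning_iff_thresholds:
  assumes game: "simple_game N v"
    and ex: "\<exists>M. minimal_winning N v M"
    and counts: "\<And>M C. minimal_winning N v M \<Longrightarrow> C \<in> N // equi_desirable N v \<Longrightarrow> card (M \<inter> C) = r C"
  shows "winning N v S \<longleftrightarrow> S \<subseteq> N \<and> (\<forall>C \<in> N // equi_desirable N v. r C \<le> card (S \<inter> C))"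
proof safe
  assume S: "winning N v S"
  have fin: "finite N" using game by (simp add: simple_game_def)
  have sub: "S \<subseteq> N" using S by (simp add: winning_def)
  then show "x \<in> N" if "x \<in> S" for x using that by blast
  fix C assume C: "C \<in> N // equi_desirable N v"
  obtain T where T: "T \<subseteq> S" "minimal_winning N v T"
    using winning_contains_minimal[OF fin S] by blast
  have "card (T \<inter> C) \<le> card (S \<inter> C)"
    using T sub fin by (intro card_mono) (auto intro: finite_subset)
  then show "r C \<le> card (S \<inter> C)" using counts[OF T(2) C] by simp
next
  assume S: "S \<subseteq> N" "\<forall>C \<in> N // equi_desirable N v. r C \<le> card (S \<inter> C)"
  obtain M where M: "minimal_winning N v M" using ex by blast
  then have "winning N v M" by (simp add: minimal_winning_def)
  then show "winning N v S"
    using winning_of_class_counts_le[OF game] S counts[OF M] by simp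
qed

text \<open>
  If a minimal winning coalition \<open>M\<close> contained a player \<open>b\<close> equivalent to the null player \<open>a\<close>, then
  \<open>M\<close> with \<open>b\<close> replaced by \<open>a\<close> would still win, and so would its part without \<open>a\<close>. But that part
  is a proper subset of \<open>M\<close>.
\<close>

lemma null_player_class_disjoint:
  assumes fin: "finite N" and null: "null_player N v a" and M: "minimal_winning N v M"
  shows "M \<inter> equi_desirable N v `` {a} = {}"
proof (rule ccontr)
  assume "\<not> ?thesis"
  then obtain b where b: "b \<in> M" "(a, b) \<in> equi_desirable N v" by blast
  have a: "a \<notin> U" if "minimal_winning N v U" for U
    using null that unfolding null_player_def by blast
  have "winning N v (transpose a b ` M)"
    using b M unfolding equi_desirable_iff minimal_winning_def by blast
  also have "transpose a b ` M = insert a (M - {b})"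
    using transpose_image_exchange[OF b(1) a[OF M]] by (simp add: transpose_commute)
  finally obtain T where T: "T \<subseteq> insert a (M - {b})" "minimal_winning N v T"
    using winning_contains_minimal[OF fin] by blast
  have "T \<subset> M" using T(1) a[OF T(2)] b by blast
  then show False
    using T(2) M by (auto simp: minimal_winning_def winning_def losing_def)
qed

text \<open>
  Membership in a class with threshold \<open>0\<close> is irrelevant for winning, so players of two such classes
  can be transposed freely and are equivalent.
\<close>

lemma zero_threshold_class_unique:
  assumes win: "\<And>S. winning N v S \<longleftrightarrow>
        S \<subseteq> N \<and> (\<forall>C \<in> N // equi_desirable N v. r C \<le> card (S \<inter> C))"
    and C: "C \<in> N // equi_desirable N v" "r C = (0::nat)"
    and D: "D \<in> N // equi_desirable N v" "r D = 0"
  shows "C = D"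
proof -
  let ?E = "equi_desirable N v"
  note eq = equiv_equi_desirable[of N v]
  obtain a b where a: "a \<in> C" and b: "b \<in> D"
    using in_quotient_imp_non_empty[OF eq C(1)] in_quotient_imp_non_empty[OF eq D(1)] by blast
  have abN: "a \<in> N" "b \<in> N"
    using in_quotient_imp_subset[OF eq] C D a b by blast+
  have pres: "winning N v (transpose a b ` S)" if S: "winning N v S" for S
  proof -
    have "transpose a b ` S \<subseteq> N"
      using S abN by (auto simp: win transpose_def)
    moreover have "r B \<le> card (transpose a b ` S \<inter> B)" if B: "B \<in> N // ?E" for B
    proof (cases "B = C \<or> B = D")
      case True
      then show ?thesis using C D by auto
    next
      case False
      then have "a \<notin> B" "b \<notin> B"
        using quotient_disj[OF eq B C(1)] quotient_disj[OF eq B D(1)] a b by blast+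
      then have "transpose a b ` S \<inter> B = S \<inter> B"
        by (force simp: transpose_def image_iff split: if_splits)
      then show ?thesis using S B by (simp add: win)
    qed
    ultimately show ?thesis by (simp add: win)
  qed
  have "winning N v (transpose a b ` S) \<longleftrightarrow> winning N v S" for S
    using pres[of S] pres[of "transpose a b ` S"] by (auto simp: image_comp)
  then have "(a, b) \<in> ?E" using abN by (simp add: equi_desirable_iff)
  then show ?thesis
    using quotient_eqI[OF eq C(1) D(1) a b] by blast
qed

theorem corollary4p2:
  fixes N :: "'a set" and v :: "'a set \<Rightarrow> nat"
    and n m :: "nat list" and t :: nat
  assumes "length n = t" and "\<forall>i<t. n ! i > 0"
    and "length m = t"
    and "characterizes n m N v"
    and "\<not> (\<exists>a. veto_player N v a)"
    and "\<exists>a. null_player N v a"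
  shows "dimension N v = t - 1"
proof -
  let ?Q = "N // equi_desirable N v"
  note eq = equiv_equi_desirable[of N v]
  have game: "simple_game N v"
    using assms(4) by (simp add: characterizes_def simple_game_with_minimum_def)
  then have fin: "finite N" by (simp add: simple_game_def)
  obtain Cs where Cs: "distinct Cs" "set Cs = ?Q" "map card Cs = n"
    and vec: "minimal_winning_vectors N v Cs = {m}"
    using assms(4) unfolding characterizes_def class_enumeration_def by blast
  have cardQ: "card ?Q = t"
    using Cs assms(1) distinct_card by fastforce
  have vec_m: "coalition_vector Cs S = m" if "minimal_winning N v S" for S
    using vec that unfolding minimal_winning_vectors_def by blast
  obtain M where M: "minimal_winning N v M"
    using vec unfolding minimal_winning_vectors_def by blast
  \<comment> \<open>The entries of the vector \<open>m\<close>, indexed by the classes instead of by their positions.\<close>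
  define r where "r C = card (M \<inter> C)" for C
  have counts: "card (S \<inter> C) = r C" if "minimal_winning N v S" "C \<in> ?Q" for S C
    using vec_m[OF that(1)] vec_m[OF M] that(2) Cs(2)
    unfolding coalition_vector_def r_def by (metis map_eq_conv)
  have win: "winning N v S \<longleftrightarrow> S \<subseteq> N \<and> (\<forall>C\<in>?Q. r C \<le> card (S \<inter> C))" for S
    using winning_iff_thresholds[OF game _ counts] M by blast
  have sub: "C \<subseteq> N" if "C \<in> ?Q" for C
    using in_quotient_imp_subset[OF eq that] .
  have disj: "C \<inter> D = {}" if "C \<in> ?Q" "D \<in> ?Q" "C \<noteq> D" for C D
    using quotient_disj[OF eq that(1,2)] that(3) by blast
  \<comment> \<open>A class that every winning coalition must contain entirely would consist of veto players.\<close>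
  have below: "r C < card C" if C: "C \<in> ?Q" for C
  proof (rule ccontr)
    assume "\<not> ?thesis"
    then have full: "card C \<le> r C" by simp
    obtain a where a: "a \<in> C" using in_quotient_imp_non_empty[OF eq C] by blast
    have "a \<in> S" if "winning N v S" for S
    proof -
      have "card C \<le> card (S \<inter> C)" using that C full by (auto simp: win intro: order_trans)
      then have "S \<inter> C = C" using sub[OF C] fin by (intro card_seteq) (auto intro: finite_subset)
      then show ?thesis using a by blast
    qed
    then show False
      using assms(5) a sub[OF C] unfolding veto_player_def by blast
  qed
  obtain a where a: "null_player N v a" using assms(6) by blast
  define Z where "Z = equi_desirable N v `` {a}"
  have Z: "Z \<in> ?Q" using a unfolding Z_def null_player_def by (auto intro: quotientI)
  have rZ: "r Z = 0"
    using null_player_class_disjoint[OF fin a M] unfolding r_def Z_def by simp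
  have pos: "0 < r C" if "C \<in> ?Q - {Z}" for C
    using zero_threshold_class_unique[OF win _ _ Z rZ] that by blast
  \<comment> \<open>The empty coalition loses, so it fails some threshold, which is therefore positive.\<close>
  have "\<not> winning N v {}" using game by (simp add: winning_def simple_game_def)
  then have "?Q - {Z} \<noteq> {}"
    unfolding win using rZ by fastforce
  moreover have win': "winning N v S \<longleftrightarrow> S \<subseteq> N \<and> (\<forall>C \<in> ?Q - {Z}. r C \<le> card (S \<inter> C))" for S
    unfolding win using rZ by fastforce
  ultimately have "dimension N v = card (?Q - {Z})"
    using sub below disj by (intro dimension_threshold_game[OF fin _ _ _ pos _ win']) simp_all
  then show ?thesis using cardQ Z by simp
qed

end
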